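(* Let $P\subset\mathbb{R}^n$ be a convex polytope and let $\ell:\mathbb{R}^n\to\mathbb{R}$ be a linear function which is nonconstant on every edge of $P$. Then the partition $O^-=\{O^-(v)\}_{v}$ of $P$ is a stratification if and only if the partition $O^+=\{O^+(v)\}_v$ of $P$ is a stratification.
   Context: For a vertex $v$ of $P$, $O^-(v)$ (resp. $O^+(v)$) is the union of the relative interiors of all faces $G$ of $P$ (including the vertex $\{v\}$ itself) such that $\ell$ restricted to $G$ attains its maximum (resp. minimum) over $G$ at $v$. As $v$ ranges over the vertices of $P$, the sets $O^-(v)$ form a partition of $P$, denoted $O^-$; similarly the sets $O^+(v)$ form a partition $O^+$. A partition $X=\bigcup_i S_i$ of a topological space is a stratification if for all $i,j$, $S_i\cap\overline{S_j}\neq\emptyset$ implies $S_i\subset\overline{S_j}$ (overline denotes closure). *)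

theory Defs
  imports "HOL-Analysis.Analysis"
begin

text \<open>
  Only faces containing \<open>v\<close> contribute, since the extremum is attained at the point \<open>v\<close> of \<open>G\<close>;
  so the empty face, which is also a \<^const>\<open>face_of\<close> \<open>P\<close>, plays no role.
\<close>

definition O_minus :: "'a::euclidean_space set \<Rightarrow> ('a \<Rightarrow> real) \<Rightarrow> 'a \<Rightarrow> 'a set" where
  "O_minus P l v = \<Union> {rel_interior G | G. G face_of P \<and> is_arg_max l (\<lambda>x. x \<in> G) v}"

definition O_plus :: "'a::euclidean_space set \<Rightarrow> ('a \<Rightarrow> real) \<Rightarrow> 'a \<Rightarrow> 'a set" where
  "O_plus P l v = \<Union> {rel_interior G | G. G face_of P \<and> is_arg_min l (\<lambda>x. x \<in> G) v}"

definition O_minus_partition :: "'a::euclidean_space set \<Rightarrow> ('a \<Rightarrow> real) \<Rightarrow> 'a set set" where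
  "O_minus_partition P l = O_minus P l ` {v. v extreme_point_of P}"

definition O_plus_partition :: "'a::euclidean_space set \<Rightarrow> ('a \<Rightarrow> real) \<Rightarrow> 'a set set" where
  "O_plus_partition P l = O_plus P l ` {v. v extreme_point_of P}"

definition stratification :: "'a topology \<Rightarrow> 'a set set \<Rightarrow> bool" where
  "stratification X \<S> \<longleftrightarrow>
     partition_on (topspace X) \<S> \<and>
     (\<forall>S\<in>\<S>. \<forall>T\<in>\<S>. S \<inter> (X closure_of T) \<noteq> {} \<longrightarrow> S \<subseteq> X closure_of T)"

end

theory Submission
  imports Defs
begin

text \<open>
  Say that a vertex \<open>v\<close> is the top (bottom) of a face if \<open>l\<close> is maximal (minimal) there. The partition
  \<open>O\<^sup>-\<close> is a stratification iff every face with top \<open>v\<close> lies in a face with top \<open>w\<close> whenever \<open>v\<close> belongs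
  to some face with top \<open>w\<close>. By following an increasing edge path one step at a time, this makes
  the last vertex of every such path the top of the smallest face containing the path. Since every face
  is spanned by a path from its bottom to its top, it follows that each facet of a face \<open>H\<close> contains the
  top or the bottom of \<open>H\<close>, a condition symmetric in \<open>l\<close> and \<open>-l\<close>. In turn this condition makes
  the first vertex of every increasing path the bottom of the smallest face containing the path, which
  yields the stratification property of \<open>O\<^sup>+\<close>.
\<close>

section \<open>Polytopes: relative interiors, extreme points and edges\<close>

text \<open>The smallest face containing \<open>x\<close> works: a facet of it through
  \<open>x\<close> would be a still smaller such face, and the relative interior of a polyhedron is
  what its facets leave over.\<close>

lemma polytope_rel_interior_face:
  fixes S :: "'a::euclidean_space set"
  assumes "polytope S" "x \<in> S"
  obtains F where "F face_of S" "x \<in> rel_interior F"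
proof -
  define F where "F = \<Inter> {G. G face_of S \<and> x \<in> G}"
  have F: "F face_of S"
    unfolding F_def using assms by (intro face_of_Inter) (auto intro: face_of_refl polytope_imp_convex)
  have "x \<in> F"
    by (simp add: F_def)
  moreover have "x \<notin> Q" if "Q facet_of F" for Q
  proof
    assume "x \<in> Q"
    moreover have "Q face_of S"
      using F facet_of_imp_face_of face_of_trans that by blast
    ultimately have "F \<subseteq> Q"
      by (auto simp: F_def)
    moreover have "Q \<subseteq> F"
      using face_of_imp_subset facet_of_imp_face_of that by blast
    ultimately show False
      using that by (simp add: facet_of_def)
  qed
  moreover have "polyhedron F"
    using F assms face_of_polytope_polytope polytope_imp_polyhedron by blast
  ultimately have "x \<in> rel_interior F"
    by (auto simp: rel_interior_of_polyhedron)
  then show thesis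
    using F that by blast
qed

text \<open>By Krein-Milman, \<open>S\<close> would otherwise lie in the convex set where
  \<open>f\<close> is below \<open>f x\<close>, contradicting \<open>x \<in> S\<close>.\<close>

lemma compact_convex_extreme_point_ge:
  fixes f :: "'a::euclidean_space \<Rightarrow> real"
  assumes "compact S" "convex S" "linear f" "x \<in> S"
  obtains v where "v extreme_point_of S" "f x \<le> f v"
proof -
  have "\<exists>v. v extreme_point_of S \<and> f x \<le> f v"
  proof (rule ccontr)
    assume "\<nexists>v. v extreme_point_of S \<and> f x \<le> f v"
    then have "{v. v extreme_point_of S} \<subseteq> f -` {..< f x}"
      by (auto simp: not_le)
    moreover have "convex (f -` {..< f x})"
      using assms by (intro convex_linear_vimage) auto
    ultimately have "convex hull {v. v extreme_point_of S} \<subseteq> f -` {..< f x}"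
      by (rule hull_minimal)
    moreover have "S = convex hull {v. v extreme_point_of S}"
      using Krein_Milman_Minkowski assms by blast
    ultimately show False
      using assms by auto
  qed
  then show thesis
    using that by blast
qed

text \<open>
  An extreme point of the section of \<open>S\<close> by a hyperplane separating \<open>v\<close> from the other
  vertices lies on an edge through \<open>v\<close>, and \<open>f\<close> restricted to this section is maximal at such a point.
\<close>

lemma polytope_improving_edge:
  fixes S :: "'a::euclidean_space set" and f :: "'a \<Rightarrow> real"
  assumes S: "polytope S" and v: "v extreme_point_of S"
    and f: "linear f" and x: "x \<in> S" "f v < f x"
  obtains w where "closed_segment v w face_of S" "f v < f w"
proof -
  have S': "compact S" "convex S"
    using S by (auto simp: polytope_imp_compact polytope_imp_convex)
  define V where "V = {v. v extreme_point_of S}"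
  define K where "K = convex hull (V - {v})"
  have "finite V"
    unfolding V_def by (simp add: S finite_polyhedron_extreme_points polytope_imp_polyhedron)
  have "V \<subseteq> S"
    by (auto simp: V_def extreme_point_of_def)
  then have "K \<subseteq> S"
    unfolding K_def by (intro hull_minimal) (auto simp: S')
  have "v \<notin> K"
  proof
    assume "v \<in> K"
    then have "v extreme_point_of K"
      using v \<open>K \<subseteq> S\<close> by (auto simp: extreme_point_of_def)
    then show False
      unfolding K_def using extreme_point_of_convex_hull by blast
  qed
  moreover have "closed K" "convex K"
    using \<open>finite V\<close> by (auto simp: K_def intro!: compact_imp_closed finite_imp_compact_convex_hull)
  ultimately obtain a b where ab: "a \<bullet> v < b" "\<And>y. y \<in> K \<Longrightarrow> b < a \<bullet> y"
    using separating_hyperplane_closed_point by metis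
  have VK: "u \<in> K" if "u \<in> V" "u \<noteq> v" for u
    using that by (auto simp: K_def hull_inc)
  define T where "T = S \<inter> {y. a \<bullet> y = b}"
  have T: "compact T" "convex T"
    unfolding T_def using S' by (auto intro!: convex_Int closed_hyperplane convex_hyperplane)
  obtain x' where x': "x' extreme_point_of S" "f x \<le> f x'"
    by (rule compact_convex_extreme_point_ge[OF S' f x(1)])
  then have x'V: "x' \<in> V" "x' \<noteq> v"
    using x by (auto simp: V_def)
  then have "b < a \<bullet> x'"
    using VK ab by blast
  \<comment> \<open>The parameter at which the segment from \<open>v\<close> to \<open>x'\<close>
    crosses the hyperplane.\<close>
  define t where "t = (b - a \<bullet> v) / (a \<bullet> x' - a \<bullet> v)"
  have t: "0 < t" "t < 1"
    using ab \<open>b < a \<bullet> x'\<close> by (auto simp: t_def)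
  define s0 where "s0 = v + t *\<^sub>R (x' - v)"
  have "s0 = (1 - t) *\<^sub>R v + t *\<^sub>R x'"
    by (simp add: s0_def algebra_simps)
  then have "s0 \<in> S"
    using t x'V v \<open>V \<subseteq> S\<close> S' by (auto simp: V_def intro!: convexD_alt)
  moreover have "a \<bullet> s0 = b"
    using ab \<open>b < a \<bullet> x'\<close> by (simp add: s0_def t_def inner_add_right inner_diff_right)
  ultimately have "s0 \<in> T"
    by (simp add: T_def)
  have "f s0 = f v + t * (f x' - f v)"
    using f by (simp add: s0_def linear_add linear_cmul linear_diff)
  then have "f v < f s0"
    using t x x' by simp
  obtain s where s: "s extreme_point_of T" "f s0 \<le> f s"
    by (rule compact_convex_extreme_point_ge[OF T f \<open>s0 \<in> T\<close>])
  then have sS: "s \<in> S" "a \<bullet> s = b"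
    by (auto simp: extreme_point_of_def T_def)
  obtain F where F: "F face_of S" "s \<in> rel_interior F"
    using polytope_rel_interior_face S sS by blast
  then have "s \<in> F" "F \<subseteq> S"
    using rel_interior_subset face_of_imp_subset by blast+
  \<comment> \<open>In dimension at least 2, the section of \<open>affine hull F\<close> by the
    hyperplane contains a line through \<open>s\<close>, so \<open>s\<close> is the midpoint of a
    segment in \<open>T\<close> and not extreme.\<close>
  have "aff_dim F \<le> 1"
  proof (rule ccontr)
    assume "\<not> aff_dim F \<le> 1"
    define L where "L = affine hull F \<inter> {y. a \<bullet> y = b}"
    have "s \<in> L"
      using \<open>s \<in> F\<close> sS by (simp add: L_def hull_inc)
    then have "aff_dim L \<ge> 1"
      using \<open>\<not> aff_dim F \<le> 1\<close> aff_dim_affine_Int_hyperplane[of "affine hull F" a b]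
      by (auto simp: L_def split: if_splits)
    then have "L \<noteq> {s}"
      by auto
    then obtain z where z: "z \<in> L" "z \<noteq> s"
      using \<open>s \<in> L\<close> by blast
    obtain e where e: "e > 0" "ball s e \<inter> affine hull F \<subseteq> F"
      using F by (auto simp: mem_rel_interior_ball)
    define d where "d = (e / (2 * norm (z - s))) *\<^sub>R (z - s)"
    have d: "norm d < e" "d \<noteq> 0"
      using e z by (auto simp: d_def)
    have aff: "affine L"
      unfolding L_def by (intro affine_Int affine_affine_hull affine_hyperplane)
    have L: "s + c *\<^sub>R (z - s) \<in> L" for c
      using mem_affine[OF aff \<open>s \<in> L\<close> z(1), of "1 - c" c] by (simp add: algebra_simps)
    have "s + d \<in> L" "s - d \<in> L"
      using L[of "e / (2 * norm (z - s))"] L[of "- (e / (2 * norm (z - s)))"] by (auto simp: d_def)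
    moreover have "s + d \<in> ball s e" "s - d \<in> ball s e"
      using d by (auto simp: dist_norm)
    ultimately have "s + d \<in> F \<inter> L" "s - d \<in> F \<inter> L"
      using e by (auto simp: L_def)
    then have "s + d \<in> T" "s - d \<in> T"
      using \<open>F \<subseteq> S\<close> by (auto simp: L_def T_def)
    moreover have "s \<in> open_segment (s - d) (s + d)"
      using d by (auto simp: in_segment algebra_simps scaleR_2[symmetric] intro!: exI[of _ "1/2"])
    ultimately show False
      using s by (auto simp: extreme_point_of_def)
  qed
  moreover have "compact F" "convex F" "F \<noteq> {}"
    using F S face_of_polytope_polytope polytope_imp_compact polytope_imp_convex \<open>s \<in> F\<close> by blast+
  ultimately obtain p q where pq: "F = closed_segment p q"
    using compact_convex_collinear_segment collinear_aff_dim by metis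
  then have "p \<in> V" "q \<in> V"
    using extreme_point_of_face[OF F(1)] extreme_point_of_segment by (auto simp: V_def)
  have "s \<notin> K"
    using sS ab by fastforce
  \<comment> \<open>\<open>K\<close> lies strictly beyond the hyperplane through \<open>s\<close>,
    so the two endpoints cannot both be in \<open>K\<close>.\<close>
  then have "p = v \<or> q = v"
    using VK \<open>p \<in> V\<close> \<open>q \<in> V\<close> \<open>s \<in> F\<close> \<open>convex K\<close> pq
    by (metis closed_segment_subset subsetD)
  then obtain w where w: "F = closed_segment v w"
    using pq closed_segment_commute by metis
  then obtain c where c: "0 \<le> c" "s = (1 - c) *\<^sub>R v + c *\<^sub>R w"
    using \<open>s \<in> F\<close> by (auto simp: in_segment)
  have "f s = f v + c * (f w - f v)"
    using f by (simp add: c(2) linear_add linear_cmul linear_diff algebra_simps)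
  then have "0 < c * (f w - f v)"
    using s \<open>f v < f s0\<close> by simp
  then have "f v < f w"
    using c by (simp add: zero_less_mult_iff)
  then show thesis
    using that F w by blast
qed

section \<open>Setup: extrema on faces, edge paths, face hulls\<close>

locale generic_polytope =
  fixes P :: "'a::euclidean_space set" and l :: "'a \<Rightarrow> real"
  assumes polytope: "polytope P"
    and linear: "linear l"
    and not_constant_on_edge: "E edge_of P \<Longrightarrow> \<not> l constant_on E"
begin

definition max_at :: "'a set \<Rightarrow> 'a \<Rightarrow> bool" where
  "max_at F v \<longleftrightarrow> F face_of P \<and> v \<in> F \<and> (\<forall>x\<in>F. l x \<le> l v)"

definition min_at :: "'a set \<Rightarrow> 'a \<Rightarrow> bool" where
  "min_at F v \<longleftrightarrow> F face_of P \<and> v \<in> F \<and> (\<forall>x\<in>F. l v \<le> l x)"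

text \<open>The set argument records only which vertices are visited, because later only the
  smallest face containing them matters.\<close>

inductive ascending :: "'a \<Rightarrow> 'a set \<Rightarrow> 'a \<Rightarrow> bool" for u where
  start: "u extreme_point_of P \<Longrightarrow> ascending u {u} u"
| step: "ascending u A v \<Longrightarrow> closed_segment v w face_of P \<Longrightarrow> l v < l w \<Longrightarrow> ascending u (insert w A) w"

abbreviation face_hull :: "'a set \<Rightarrow> 'a set" where
  "face_hull A \<equiv> (\<lambda>F. F face_of P) hull A"

text \<open>Combinatorial form of the stratification property of \<open>O_minus\<close>:
  \<open>v \<in> G\<close> expresses that the stratum of \<open>v\<close> meets the closure of the
  stratum of \<open>w\<close>, the existence of \<open>H\<close> for every \<open>F\<close> that it
  is contained in it.\<close>

definition extends_up :: bool where
  "extends_up \<longleftrightarrow> (\<forall>v w F G. max_at F v \<longrightarrow> max_at G w \<longrightarrow> v \<in> G \<longrightarrow> (\<exists>H. F \<subseteq> H \<and> max_at H w))"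

definition extends_down :: bool where
  "extends_down \<longleftrightarrow> (\<forall>v w F G. min_at F v \<longrightarrow> min_at G w \<longrightarrow> v \<in> G \<longrightarrow> (\<exists>H. F \<subseteq> H \<and> min_at H w))"

lemma generic_uminus: "generic_polytope P (\<lambda>x. - l x)"
proof (rule generic_polytope.intro)
  show "linear (\<lambda>x. - l x)"
    using linear by (simp add: linear_compose_neg)
  show "\<not> (\<lambda>x. - l x) constant_on E" if "E edge_of P" for E
  proof
    assume "(\<lambda>x. - l x) constant_on E"
    then obtain c where "\<And>x. x \<in> E \<Longrightarrow> - l x = c"
      unfolding constant_on_def by blast
    then have "\<And>x. x \<in> E \<Longrightarrow> l x = - c"
      by (metis minus_minus)
    then have "l constant_on E"
      unfolding constant_on_def by blast
    then show False
      using not_constant_on_edge that by blast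
  qed
qed (rule polytope)

lemma max_at_uminus: "generic_polytope.max_at P (\<lambda>x. - l x) F v \<longleftrightarrow> min_at F v"
  by (simp add: generic_polytope.max_at_def[OF generic_uminus] min_at_def)

lemma min_at_uminus: "generic_polytope.min_at P (\<lambda>x. - l x) F v \<longleftrightarrow> max_at F v"
  by (simp add: generic_polytope.min_at_def[OF generic_uminus] max_at_def)

lemma polytope_face: "F face_of P \<Longrightarrow> polytope F"
  using polytope face_of_polytope_polytope by blast

text \<open>\<open>A \<subseteq> P\<close> puts \<open>P\<close> itself into the intersected family,
  which is therefore nonempty.\<close>

lemma face_hull_face: "A \<subseteq> P \<Longrightarrow> face_hull A face_of P"
  unfolding hull_def using polytope
  by (intro face_of_Inter) (auto intro: face_of_refl polytope_imp_convex)

lemma face_hull_minimal: "A \<subseteq> F \<Longrightarrow> F face_of P \<Longrightarrow> face_hull A \<subseteq> F"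
  by (rule hull_minimal)

lemma face_hull_eq: "F face_of P \<Longrightarrow> face_hull F = F"
  by (rule hull_same)

section \<open>Uniqueness and existence of extrema on faces\<close>

text \<open>The maximal points of \<open>l\<close> on \<open>F\<close> form a face; if it had two
  points, it would contain an edge of \<open>P\<close> on which \<open>l\<close> is
  constant.\<close>

lemma max_at_unique:
  assumes "max_at F v" "x \<in> F" "l v \<le> l x"
  shows "x = v"
proof -
  define M where "M = {y \<in> F. l y = l v}"
  have F: "F face_of P" "v \<in> F" "\<And>y. y \<in> F \<Longrightarrow> l y \<le> l v"
    using assms by (auto simp: max_at_def)
  \<comment> \<open>The vector representing \<open>l\<close> as an inner product, so that the
    maximal points are cut out by a supporting hyperplane.\<close>
  define a where "a = adjoint l 1"
  have a: "l y = a \<bullet> y" for y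
    using adjoint_works[OF linear, of y 1] by (simp add: a_def inner_commute)
  have "M = F \<inter> {y. a \<bullet> y = a \<bullet> v}"
    by (auto simp: M_def a)
  moreover have "F \<inter> {y. a \<bullet> y = a \<bullet> v} face_of F"
    using F polytope_face polytope_imp_convex
    by (intro face_of_Int_supporting_hyperplane_le) (auto simp: a)
  ultimately have M: "M face_of P"
    using F face_of_trans by metis
  have "x \<in> M" "v \<in> M"
    using assms F by (auto simp: M_def order_antisym)
  show ?thesis
  proof (rule ccontr)
    assume "x \<noteq> v"
    have "compact M" "convex M"
      using M polytope_face polytope_imp_compact polytope_imp_convex by blast+
    moreover have "M \<noteq> {}"
      using \<open>v \<in> M\<close> by blast
    ultimately obtain p where p: "p extreme_point_of M"
      using extreme_point_exists_convex by blast
    then obtain q where q: "q \<in> M" "q \<noteq> p"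
      using \<open>x \<in> M\<close> \<open>v \<in> M\<close> \<open>x \<noteq> v\<close> by metis
    \<comment> \<open>As \<open>l\<close> is constant on \<open>M\<close>, another functional has to
      produce the edge; this one is larger at \<open>q\<close> than at \<open>p\<close>.\<close>
    have "linear (\<lambda>y. (q - p) \<bullet> y)"
      by (simp add: bounded_linear.linear bounded_linear_inner_right)
    moreover have "(q - p) \<bullet> p < (q - p) \<bullet> q"
      using q inner_gt_zero_iff[of "q - p"] by (simp add: inner_diff_right)
    ultimately obtain w where w: "closed_segment p w face_of M" "(q - p) \<bullet> p < (q - p) \<bullet> w"
      using polytope_improving_edge[OF polytope_face[OF M] p _ q(1)] by metis
    have "closed_segment p w face_of P"
      using M w face_of_trans by blast
    moreover have "p \<noteq> w"
      using w by auto
    ultimately have "closed_segment p w edge_of P"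
      by (simp add: edge_of_def segment_convex_hull aff_dim_convex_hull aff_dim_2)
    moreover have "closed_segment p w \<subseteq> M"
      using w face_of_imp_subset by blast
    then have "l constant_on closed_segment p w"
      by (auto simp: M_def constant_on_def)
    ultimately show False
      using not_constant_on_edge by blast
  qed
qed

lemma max_at_extreme:
  assumes "max_at F v"
  shows "v extreme_point_of P"
proof -
  have F: "F face_of P" "v \<in> F"
    using assms by (auto simp: max_at_def)
  obtain e where e: "e extreme_point_of F" "l v \<le> l e"
    using compact_convex_extreme_point_ge[OF _ _ linear F(2)] F polytope_face
      polytope_imp_compact polytope_imp_convex by blast
  then have "e = v"
    using assms max_at_unique by (auto simp: extreme_point_of_def)
  then show ?thesis
    using e F extreme_point_of_face by blast
qed

lemma max_at_exists:
  assumes "F face_of P" "F \<noteq> {}"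
  obtains v where "max_at F v"
proof -
  have "compact F"
    using assms polytope_face polytope_imp_compact by blast
  moreover have "continuous_on F l"
    by (simp add: linear linear_continuous_on linear_linear)
  ultimately show thesis
    using continuous_attains_sup[of F l] assms that by (auto simp: max_at_def)
qed

lemmas min_at_unique =
  generic_polytope.max_at_unique[OF generic_uminus, unfolded max_at_uminus neg_le_iff_le]

lemmas min_at_exists =
  generic_polytope.max_at_exists[OF generic_uminus, unfolded max_at_uminus]

lemmas min_at_extreme =
  generic_polytope.max_at_extreme[OF generic_uminus, unfolded max_at_uminus]

section \<open>Ascending edge paths\<close>

lemma ascending_extreme: "ascending u A v \<Longrightarrow> x \<in> A \<Longrightarrow> x extreme_point_of P"
  by (induction rule: ascending.induct)
    (auto simp: extreme_point_of_segment dest: extreme_point_of_face)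

lemma ascending_subset: "ascending u A v \<Longrightarrow> A \<subseteq> P"
  using ascending_extreme by (auto simp: extreme_point_of_def)

lemma ascending_end: "ascending u A v \<Longrightarrow> v \<in> A"
  by (induction rule: ascending.induct) auto

lemma ascending_start: "ascending u A v \<Longrightarrow> u \<in> A"
  by (induction rule: ascending.induct) auto

lemma ascending_trans:
  assumes "ascending v B w" "ascending u A v"
  shows "ascending u (A \<union> B) w"
  using assms(1)
proof induction
  case start
  then show ?case
    using assms(2) ascending_end by (simp add: insert_absorb)
next
  case (step B x w)
  then show ?case
    by (simp add: ascending.step)
qed

lemma finite_extreme: "finite {x. x extreme_point_of P}"
  by (simp add: polytope finite_polyhedron_extreme_points polytope_imp_polyhedron)

text \<open>The functional is arbitrary so that the same edge step serves for moving up, with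
  \<open>l\<close>, and down, with \<open>-l\<close>.\<close>

lemma face_edge:
  fixes f :: "'a \<Rightarrow> real"
  assumes "G face_of P" "v extreme_point_of P" "v \<in> G" "linear f" "x \<in> G" "f v < f x"
  obtains w where "closed_segment v w face_of P" "w extreme_point_of P" "w \<in> G" "f v < f w"
proof -
  obtain w where w: "closed_segment v w face_of G" "f v < f w"
    using polytope_improving_edge[of G v f x] polytope_face assms extreme_point_of_face by metis
  then have "closed_segment v w face_of P"
    using assms face_of_trans by blast
  moreover have "w extreme_point_of P"
    using extreme_point_of_face[OF calculation, of w] extreme_point_of_segment by blast
  moreover have "w \<in> G"
    using face_of_imp_subset[OF w(1)] by auto
  ultimately show thesis
    using w that by blast
qed

text \<open>Each vertex of \<open>G\<close> other than \<open>t\<close> has an edge in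
  \<open>G\<close> leading up, and the number of vertices of \<open>P\<close> above the current one
  drops.\<close>

lemma ascending_to_max:
  assumes G: "max_at G t" and "v extreme_point_of P" "v \<in> G"
  shows "\<exists>A \<subseteq> G. ascending v A t"
  using assms(2,3)
proof (induction "card {x. x extreme_point_of P \<and> l v < l x}" arbitrary: v rule: less_induct)
  case less
  show ?case
  proof (cases "v = t")
    case True
    then show ?thesis
      using less ascending.start[of v] by (intro exI[of _ "{v}"]) auto
  next
    case False
    then have "l v < l t" "t \<in> G" "G face_of P"
      using max_at_unique[OF G less(3)] G by (auto simp: max_at_def not_le[symmetric])
    then obtain w where w: "closed_segment v w face_of P" "w extreme_point_of P" "w \<in> G" "l v < l w"
      using face_edge[OF _ less(2,3) linear] by blast
    have "{x. x extreme_point_of P \<and> l w < l x} \<subset> {x. x extreme_point_of P \<and> l v < l x}"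
      using w by auto
    then obtain A where "A \<subseteq> G" "ascending w A t"
      using less(1)[OF psubset_card_mono w(2,3)] finite_extreme by auto
    moreover have "ascending v {w, v} w"
      using ascending.step[OF ascending.start] less w by blast
    ultimately show ?thesis
      using ascending_trans[of w A t v "{w, v}"] w less by (intro exI[of _ "{w, v} \<union> A"]) auto
  qed
qed

text \<open>Paths are directed, so the path is built from its end: an edge descending from
  \<open>v\<close> to \<open>w\<close> is traversed upwards after a path from \<open>a\<close> to
  \<open>w\<close>.\<close>

lemma ascending_from_min:
  assumes G: "min_at G a" and "v extreme_point_of P" "v \<in> G"
  shows "\<exists>A \<subseteq> G. ascending a A v"
  using assms(2,3)
proof (induction "card {x. x extreme_point_of P \<and> l x < l v}" arbitrary: v rule: less_induct)
  case less
  show ?case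
  proof (cases "v = a")
    case True
    then show ?thesis
      using less ascending.start[of v] by (intro exI[of _ "{v}"]) auto
  next
    case False
    then have "- l v < - l a" "a \<in> G" "G face_of P"
      using min_at_unique[OF G less(3)] G by (auto simp: min_at_def not_le[symmetric])
    then obtain w where w: "closed_segment v w face_of P" "w extreme_point_of P" "w \<in> G" "- l v < - l w"
      using face_edge[OF _ less(2,3) linear_compose_neg[OF linear]] by blast
    have "{x. x extreme_point_of P \<and> l x < l w} \<subset> {x. x extreme_point_of P \<and> l x < l v}"
      using w by auto
    then obtain A where "A \<subseteq> G" "ascending a A w"
      using less(1)[OF psubset_card_mono w(2,3)] finite_extreme by auto
    then show ?thesis
      using ascending.step[of a A w v] w less
      by (intro exI[of _ "insert v A"]) (auto simp: closed_segment_commute)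
  qed
qed

section \<open>Facets and spanning paths\<close>

text \<open>Proper faces have smaller dimension, and no dimension fits strictly between those of
  \<open>Q\<close> and \<open>G\<close>.\<close>

lemma face_above_facet:
  assumes "Q facet_of G" "G face_of P" "H face_of P" "Q \<subset> H" "H \<subseteq> G"
  shows "H = G"
proof (rule ccontr)
  assume "H \<noteq> G"
  have "H face_of G" "Q face_of H"
    using assms face_of_subset face_of_imp_subset facet_of_imp_face_of
    by (metis, metis psubset_imp_subset)
  moreover have "convex G" "convex H"
    using assms polytope_face polytope_imp_convex by blast+
  ultimately have "aff_dim Q < aff_dim H" "aff_dim H < aff_dim G"
    using assms \<open>H \<noteq> G\<close> by (auto intro!: face_of_aff_dim_lt)
  then show False
    using assms by (simp add: facet_of_def)
qed

text \<open>
  A facet avoiding the maximal vertex has a spanning path by induction; extended upwards to the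
  maximum and downwards to the minimum, this path leaves the facet.
\<close>

lemma spanning_path:
  assumes "min_at G a" "max_at G t"
  shows "\<exists>A. ascending a A t \<and> face_hull A = G"
  using assms
\<comment> \<open>\<open>aff_dim\<close> is at least -1, so after the shift by 1 the conversion to a
  natural number loses nothing.\<close>
proof (induction "nat (aff_dim G + 1)" arbitrary: G a t rule: less_induct)
  case less
  have G: "G face_of P" "a \<in> G" "t \<in> G"
    using less by (auto simp: min_at_def max_at_def)
  have ext: "a extreme_point_of P" "t extreme_point_of P"
    using less min_at_extreme max_at_extreme by blast+
  show ?case
  proof (cases "a = t")
    case True
    have "x = a" if "x \<in> G" for x
      using less(3) True that by (intro min_at_unique[OF less(2)]) (auto simp: max_at_def)
    then have "G = {a}"
      using G by blast
    then show ?thesis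
      using True G ext ascending.start[of a] face_hull_eq by (intro exI[of _ "{a}"]) auto
  next
    case False
    have "{a} face_of G"
      using ext G extreme_point_of_face face_of_singleton by blast
    moreover have "polyhedron G"
      using G polytope_face polytope_imp_polyhedron by blast
    \<comment> \<open>The proper face \<open>{a}\<close> is the intersection of the facets through
      it, so one of these misses \<open>t\<close>.\<close>
    ultimately have "{a} = \<Inter> {Q. Q facet_of G \<and> {a} \<subseteq> Q}"
      using False G by (intro face_of_polyhedron) auto
    then have "t \<notin> \<Inter> {Q. Q facet_of G \<and> {a} \<subseteq> Q}"
      using False by (metis singletonD)
    then obtain Q where Q: "Q facet_of G" "t \<notin> Q"
      by blast
    then have QP: "Q face_of P" "Q \<noteq> {}" "Q \<subseteq> G"
      using G face_of_trans face_of_imp_subset unfolding facet_of_def by blast+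
    then obtain m y where my: "min_at Q m" "max_at Q y"
      using min_at_exists max_at_exists by metis
    have "nat (aff_dim Q + 1) < nat (aff_dim G + 1)"
      using Q aff_dim_geq[of Q] by (simp add: facet_of_def)
    then obtain A1 where A1: "ascending m A1 y" "face_hull A1 = Q"
      using less(1)[OF _ my] by blast
    have "m \<in> G" "y \<in> G"
      using my QP by (auto simp: min_at_def max_at_def)
    then obtain A0 A2 where A: "A0 \<subseteq> G" "ascending a A0 m" "A2 \<subseteq> G" "ascending y A2 t"
      using ascending_from_min ascending_to_max less(2,3) my min_at_extreme max_at_extreme by metis
    define A where "A = A0 \<union> (A1 \<union> A2)"
    have path: "ascending a A t"
      unfolding A_def using A A1(1) by (blast intro: ascending_trans)
    have "A1 \<subseteq> Q"
      using A1(2) hull_subset by metis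
    then have "face_hull A \<subseteq> G"
      using A QP G by (intro face_hull_minimal) (auto simp: A_def)
    moreover have "Q \<subseteq> face_hull A"
      unfolding A1(2)[symmetric] by (intro hull_mono) (auto simp: A_def)
    moreover have "t \<in> face_hull A"
      using ascending_end[OF path] by (rule hull_inc)
    ultimately have "face_hull A = G"
      using Q G by (intro face_above_facet face_hull_face ascending_subset[OF path]) auto
    then show ?thesis
      using path by blast
  qed
qed

section \<open>Face hulls of paths under \<open>extends_up\<close>\<close>

text \<open>Induction along the path: the new edge has top \<open>w\<close> and contains
  \<open>v\<close>, so \<open>extends_up\<close> enlarges the old hull to a face with top
  \<open>w\<close>, which contains the new hull.\<close>

lemma ascending_max:
  assumes up: "extends_up"
  shows "ascending u A v \<Longrightarrow> max_at (face_hull A) v"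
proof (induction rule: ascending.induct)
  case start
  then have "{u} face_of P"
    by (simp add: face_of_singleton)
  then show ?case
    by (simp add: face_hull_eq max_at_def)
next
  case (step A v w)
  have "l x \<le> l w" if x: "x \<in> closed_segment v w" for x
  proof -
    obtain c where c: "c \<le> 1" "x = (1 - c) *\<^sub>R v + c *\<^sub>R w"
      using x unfolding in_segment by blast
    have "l w - l x = (1 - c) * (l w - l v)"
      using linear by (simp add: c(2) linear_add linear_cmul linear_diff algebra_simps)
    also have "\<dots> \<ge> 0"
      using c step by simp
    finally show ?thesis
      by simp
  qed
  then have "max_at (closed_segment v w) w"
    using step by (simp add: max_at_def)
  then obtain H where H: "face_hull A \<subseteq> H" "max_at H w"
    using up step(4) unfolding extends_up_def by (meson ends_in_segment(1))
  have "ascending u (insert w A) w"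
    using step ascending.step by blast
  then have "face_hull (insert w A) face_of P"
    using face_hull_face ascending_subset by blast
  moreover have "A \<subseteq> H"
    using H hull_subset by (metis order_trans)
  then have "face_hull (insert w A) \<subseteq> H"
    using H by (intro face_hull_minimal) (auto simp: max_at_def)
  moreover have "w \<in> face_hull (insert w A)"
    by (simp add: hull_inc)
  ultimately show ?case
    using H by (auto simp: max_at_def)
qed

text \<open>
  Otherwise a path from \<open>a\<close> into \<open>Q\<close> followed by a spanning path of \<open>Q\<close> would span \<open>H\<close>, and
  \<open>t\<close> would be its end point.
\<close>

lemma facet_min_or_max:
  assumes up: "extends_up" and Q: "Q facet_of H"
    and a: "min_at H a" and t: "max_at H t" and "t \<notin> Q"
  shows "a \<in> Q"
proof (rule ccontr)
  assume "a \<notin> Q"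
  have H: "H face_of P"
    using a by (simp add: min_at_def)
  then have QP: "Q face_of P" "Q \<noteq> {}" "Q \<subseteq> H"
    using Q face_of_trans face_of_imp_subset unfolding facet_of_def by blast+
  then obtain m y where my: "min_at Q m" "max_at Q y"
    using min_at_exists max_at_exists by metis
  then obtain A where A: "ascending m A y" "face_hull A = Q"
    using spanning_path by blast
  have "m \<in> H"
    using my QP by (auto simp: min_at_def)
  then obtain B where B: "B \<subseteq> H" "ascending a B m"
    using ascending_from_min a my min_at_extreme by metis
  have path: "ascending a (B \<union> A) y"
    using A B ascending_trans by blast
  have "a \<in> face_hull (B \<union> A)"
    using ascending_start[OF path] by (rule hull_inc)
  moreover have "Q \<subseteq> face_hull (B \<union> A)"
    unfolding A(2)[symmetric] by (intro hull_mono) auto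
  moreover have "A \<subseteq> Q"
    using A hull_subset by metis
  then have "face_hull (B \<union> A) \<subseteq> H"
    using B QP H by (intro face_hull_minimal) auto
  ultimately have "face_hull (B \<union> A) = H"
    using Q H \<open>a \<notin> Q\<close> by (intro face_above_facet face_hull_face ascending_subset[OF path]) auto
  then have "max_at H y"
    using ascending_max[OF up path] by simp
  then have "y = t"
    using t by (intro max_at_unique[OF t]) (auto simp: max_at_def)
  then show False
    using my \<open>t \<notin> Q\<close> by (simp add: max_at_def)
qed

text \<open>
  The facets of \<open>H = face_hull (insert w A)\<close> containing \<open>face_hull A\<close> miss \<open>w = max H\<close>, hence all
  contain \<open>min H\<close>; so does their intersection, which is \<open>face_hull A\<close>.
\<close>

lemma ascending_min:
  assumes up: "extends_up"
  shows "ascending u A v \<Longrightarrow> min_at (face_hull A) u"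
proof (induction rule: ascending.induct)
  case start
  then have "{u} face_of P"
    by (simp add: face_of_singleton)
  then show ?case
    by (simp add: face_hull_eq min_at_def)
next
  case (step A v w)
  define F where "F = face_hull A"
  define H where "H = face_hull (insert w A)"
  have "ascending u (insert w A) w"
    using step ascending.step by blast
  then have H: "H face_of P" "max_at H w"
    unfolding H_def using ascending_max[OF up] by (auto simp: max_at_def)
  then obtain a where a: "min_at H a"
    using min_at_exists by (metis empty_iff max_at_def)
  have F: "max_at F v" "min_at F u"
    using ascending_max[OF up step(1)] step by (auto simp: F_def)
  have "F \<subseteq> H"
    unfolding F_def H_def by (intro hull_mono) auto
  then have "F face_of H"
    using F H face_of_subset face_of_imp_subset by (metis max_at_def)
  \<comment> \<open>\<open>l w\<close> exceeds \<open>l v\<close>, the maximum of \<open>l\<close>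
    on \<open>F\<close>.\<close>
  moreover have "F \<noteq> H"
    using F H step(3) by (force simp: max_at_def)
  moreover have "polyhedron H" "F \<noteq> {}"
    using H F polytope_face polytope_imp_polyhedron by (auto simp: max_at_def)
  ultimately have "F = \<Inter> {Q. Q facet_of H \<and> F \<subseteq> Q}"
    by (intro face_of_polyhedron)
  moreover have "a \<in> Q" if Q: "Q facet_of H" "F \<subseteq> Q" for Q
  proof (rule facet_min_or_max[OF up Q(1) a H(2)])
    show "w \<notin> Q"
    proof
      assume "w \<in> Q"
      moreover have "A \<subseteq> Q"
        using Q hull_subset by (metis F_def order_trans)
      moreover have "Q face_of P"
        using Q H face_of_trans facet_of_imp_face_of by blast
      ultimately have "H \<subseteq> Q"
        unfolding H_def by (intro face_hull_minimal) auto
      then have "Q = H"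
        using Q face_of_imp_subset facet_of_imp_face_of by blast
      then show False
        using Q by (simp add: facet_of_def)
    qed
  qed
  ultimately have "a \<in> F"
    by blast
  \<comment> \<open>\<open>a\<close> is minimal on \<open>H\<close>, hence on its subset
    \<open>F\<close>, where the minimal point is unique.\<close>
  then have "a = u"
    using a F \<open>F \<subseteq> H\<close> by (intro min_at_unique[OF F(2)]) (auto simp: min_at_def)
  then show ?case
    using a by (simp add: H_def)
qed

section \<open>Symmetry between the upward and downward conditions\<close>

text \<open>A path from \<open>u\<close> to \<open>v\<close> continued by a spanning path of
  \<open>F\<close> has a hull that contains \<open>F\<close> and, by \<open>ascending_min\<close>,
  has bottom \<open>u\<close>.\<close>

lemma extends_up_imp_down:
  assumes up: "extends_up"
  shows "extends_down"
  unfolding extends_down_def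
proof (intro allI impI)
  fix v u F G
  assume F: "min_at F v" and G: "min_at G u" and "v \<in> G"
  obtain A where A: "ascending u A v"
    using ascending_from_min[OF G] F \<open>v \<in> G\<close> min_at_extreme by blast
  obtain t where "max_at F t"
    using max_at_exists F by (metis empty_iff min_at_def)
  then obtain B where B: "ascending v B t" "face_hull B = F"
    using spanning_path F by blast
  have "min_at (face_hull (A \<union> B)) u"
    using ascending_min[OF up] ascending_trans A B by blast
  moreover have "F \<subseteq> face_hull (A \<union> B)"
    unfolding B(2)[symmetric] by (intro hull_mono) auto
  ultimately show "\<exists>H. F \<subseteq> H \<and> min_at H u"
    by blast
qed

lemma extends_up_uminus: "generic_polytope.extends_up P (\<lambda>x. - l x) \<longleftrightarrow> extends_down"
  by (simp add: generic_polytope.extends_up_def[OF generic_uminus] extends_down_def max_at_uminus)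

lemma extends_down_uminus: "generic_polytope.extends_down P (\<lambda>x. - l x) \<longleftrightarrow> extends_up"
  by (simp add: generic_polytope.extends_down_def[OF generic_uminus] extends_up_def min_at_uminus)

lemma extends_up_iff_down: "extends_up \<longleftrightarrow> extends_down"
  using extends_up_imp_down generic_polytope.extends_up_imp_down[OF generic_uminus]
  by (auto simp: extends_up_uminus extends_down_uminus)

section \<open>Strata, their closures and the stratification property\<close>

lemma O_minus_eq: "O_minus P l v = \<Union> {rel_interior F |F. max_at F v}"
  by (auto simp: O_minus_def max_at_def is_arg_max_linorder)

lemma O_plus_eq: "O_plus P l = O_minus P (\<lambda>x. - l x)"
  by (simp add: O_plus_def O_minus_def is_arg_max_linorder is_arg_min_linorder fun_eq_iff)

lemma O_minus_subset: "O_minus P l v \<subseteq> P"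
  using rel_interior_subset face_of_imp_subset by (fastforce simp: O_minus_eq max_at_def)

lemma mem_O_minus:
  assumes "v extreme_point_of P"
  shows "v \<in> O_minus P l v"
proof -
  have "max_at {v} v"
    using assms by (simp add: max_at_def face_of_singleton)
  moreover have "v \<in> rel_interior {v}"
    by simp
  ultimately show ?thesis
    unfolding O_minus_eq by blast
qed

text \<open>A face that meets the relative interior of another face contains it; this applies in
  both directions.\<close>

lemma face_rel_interior_unique:
  assumes "F face_of P" "G face_of P" "x \<in> rel_interior F" "x \<in> rel_interior G"
  shows "F = G"
  using assms subset_of_face_of[of F P G] subset_of_face_of[of G P F]
    rel_interior_subset[of F] rel_interior_subset[of G] face_of_imp_subset
  by blast

text \<open>Each point lies in the relative interior of exactly one face, and each nonempty face has
  exactly one top.\<close>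

lemma O_minus_partition: "partition_on P (O_minus_partition P l)"
proof (rule partition_onI)
  show "\<Union> (O_minus_partition P l) = P"
  proof
    show "P \<subseteq> \<Union> (O_minus_partition P l)"
    proof
      fix x assume "x \<in> P"
      then obtain F where F: "F face_of P" "x \<in> rel_interior F"
        using polytope_rel_interior_face[OF polytope] by blast
      then obtain v where "max_at F v"
        using max_at_exists by (metis empty_iff rel_interior_empty)
      then show "x \<in> \<Union> (O_minus_partition P l)"
        using F max_at_extreme by (auto simp: O_minus_partition_def O_minus_eq)
    qed
  qed (use O_minus_subset in \<open>auto simp: O_minus_partition_def\<close>)
  show "disjnt S T" if ST: "S \<in> O_minus_partition P l" "T \<in> O_minus_partition P l" "S \<noteq> T" for S T
  proof (rule ccontr)
    assume "\<not> disjnt S T"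
    then obtain x v w where S: "S = O_minus P l v" "T = O_minus P l w"
      "x \<in> O_minus P l v" "x \<in> O_minus P l w"
      using ST unfolding disjnt_iff O_minus_partition_def by blast
    then obtain F G where x:
      "x \<in> rel_interior F" "max_at F v" "x \<in> rel_interior G" "max_at G w"
      unfolding O_minus_eq by blast
    then have "F = G"
      using face_rel_interior_unique by (auto simp: max_at_def)
    then have "v = w"
      using x by (intro max_at_unique[of G w]) (auto simp: max_at_def)
    then show False
      using S ST by simp
  qed
  show "{} \<notin> O_minus_partition P l"
    using mem_O_minus by (force simp: O_minus_partition_def)
qed

text \<open>A polytope has finitely many faces, and each is the closure of its relative interior.
  The union lies in \<open>P\<close>, so closure in the subspace agrees with closure in the whole
  space.\<close>

lemma closure_O_minus:
  "top_of_set P closure_of O_minus P l v = \<Union> {F. max_at F v}"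
proof -
  have fin: "finite {F. max_at F v}"
    by (rule finite_subset[OF _ finite_polytope_faces[OF polytope]]) (auto simp: max_at_def)
  have pol: "polytope F" if "max_at F v" for F
    using that polytope_face by (simp add: max_at_def)
  have "closure (O_minus P l v) = \<Union> {F. max_at F v}"
  proof
    have "closed (\<Union> {F. max_at F v})"
      using fin pol polytope_imp_closed by (intro closed_Union) auto
    then show "closure (O_minus P l v) \<subseteq> \<Union> {F. max_at F v}"
      using rel_interior_subset by (intro closure_minimal) (fastforce simp: O_minus_eq)+
    show "\<Union> {F. max_at F v} \<subseteq> closure (O_minus P l v)"
    proof (rule Union_least)
      fix F assume "F \<in> {F. max_at F v}"
      then have F: "max_at F v"
        by simp
      have "F = closure (rel_interior F)"
        using pol[OF F] by (simp add: convex_closure_rel_interior polytope_imp_convex polytope_imp_closed)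
      also have "\<dots> \<subseteq> closure (O_minus P l v)"
        using F by (intro closure_mono) (auto simp: O_minus_eq)
      finally show "F \<subseteq> closure (O_minus P l v)" .
    qed
  qed
  moreover have "\<Union> {F. max_at F v} \<subseteq> P"
    using face_of_imp_subset by (auto simp: max_at_def)
  ultimately show ?thesis
    using O_minus_subset[of v]
    by (simp add: closure_of_subtopology euclidean_closure_of Int_absorb1)
qed

text \<open>If the relative interior of \<open>F\<close> meets \<open>G\<close>, then
  \<open>F\<close>, and with it \<open>v\<close>, lies in \<open>G\<close>; conversely a vertex
  \<open>v\<close> belongs to its own stratum.\<close>

lemma O_minus_meets_closure_iff:
  "O_minus P l v \<inter> (top_of_set P closure_of O_minus P l w) \<noteq> {}
    \<longleftrightarrow> v extreme_point_of P \<and> (\<exists>G. max_at G w \<and> v \<in> G)" (is "?L \<longleftrightarrow> ?R")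
proof
  assume ?L
  then obtain x F G where x: "max_at F v" "x \<in> rel_interior F" "max_at G w" "x \<in> G"
    unfolding closure_O_minus by (auto simp: O_minus_eq)
  then have "F \<subseteq> G"
    using subset_of_face_of[of G P F] face_of_imp_subset by (auto simp: max_at_def)
  then show ?R
    using x max_at_extreme by (auto simp: max_at_def)
next
  assume ?R
  then show ?L
    using mem_O_minus by (auto simp: closure_O_minus)
qed

text \<open>One point in the relative interior of \<open>F\<close> suffices: any face
  \<open>H\<close> through it contains all of \<open>F\<close>.\<close>

lemma O_minus_subset_closure_iff:
  "O_minus P l v \<subseteq> top_of_set P closure_of O_minus P l w
    \<longleftrightarrow> (\<forall>F. max_at F v \<longrightarrow> (\<exists>H. F \<subseteq> H \<and> max_at H w))" (is "?L \<longleftrightarrow> ?R")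
proof
  assume ?L
  show ?R
  proof (intro allI impI)
    fix F assume F: "max_at F v"
    then have "F face_of P" "F \<noteq> {}"
      by (auto simp: max_at_def)
    then obtain x where x: "x \<in> rel_interior F"
      using polytope_face polytope_imp_convex rel_interior_eq_empty by blast
    then have "x \<in> O_minus P l v"
      using F by (auto simp: O_minus_eq)
    then obtain H where H: "max_at H w" "x \<in> H"
      using \<open>?L\<close> by (auto simp: closure_O_minus)
    then have "F \<subseteq> H"
      using x \<open>F face_of P\<close> subset_of_face_of[of H P F] face_of_imp_subset by (auto simp: max_at_def)
    then show "\<exists>H. F \<subseteq> H \<and> max_at H w"
      using H by blast
  qed
next
  assume R: ?R
  show ?L
  proof
    fix x assume "x \<in> O_minus P l v"
    then obtain F where F: "max_at F v" "x \<in> rel_interior F"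
      by (auto simp: O_minus_eq)
    then obtain H where "F \<subseteq> H" "max_at H w"
      using R by blast
    moreover have "x \<in> F"
      using F rel_interior_subset by blast
    ultimately show "x \<in> top_of_set P closure_of O_minus P l w"
      unfolding closure_O_minus by blast
  qed
qed

text \<open>The partition ranges over vertices only, \<open>extends_up\<close> over all points; they
  agree because \<open>max_at\<close> forces its point to be a vertex.\<close>

lemma stratification_O_minus:
  "stratification (top_of_set P) (O_minus_partition P l) \<longleftrightarrow> extends_up"
proof -
  have "stratification (top_of_set P) (O_minus_partition P l) \<longleftrightarrow>
    (\<forall>v w. v extreme_point_of P \<longrightarrow> w extreme_point_of P \<longrightarrow>
      (\<exists>G. max_at G w \<and> v \<in> G) \<longrightarrow> (\<forall>F. max_at F v \<longrightarrow> (\<exists>H. F \<subseteq> H \<and> max_at H w)))"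
    using O_minus_partition
    by (auto simp: stratification_def O_minus_partition_def O_minus_meets_closure_iff
        O_minus_subset_closure_iff)
  also have "\<dots> \<longleftrightarrow> extends_up"
    unfolding extends_up_def
    by (intro iffI allI impI) (blast dest: max_at_extreme)+
  finally show ?thesis .
qed

lemma stratification_O_plus:
  "stratification (top_of_set P) (O_plus_partition P l) \<longleftrightarrow> extends_down"
  using generic_polytope.stratification_O_minus[OF generic_uminus]
  by (simp add: O_plus_partition_def O_plus_eq O_minus_partition_def extends_up_uminus)

end

theorem theorem2p22:
  fixes P :: "(real ^ 'n) set" and l :: "real ^ 'n \<Rightarrow> real"
  assumes "polytope P"
    and "linear l"
    and "\<And>E. E edge_of P \<Longrightarrow> \<not> l constant_on E"
  shows "stratification (top_of_set P) (O_minus_partition P l)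
     \<longleftrightarrow> stratification (top_of_set P) (O_plus_partition P l)"
proof -
  interpret generic_polytope P l
    using assms by (rule generic_polytope.intro)
  show ?thesis
    by (simp add: stratification_O_minus stratification_O_plus extends_up_iff_down)
qed

end
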